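(* Let $T, D \ge 1$ be integers, let $s_0 \in \mathbb{R}^D$, and let $f_1,\dots,f_T : \mathbb{R}^D \to \mathbb{R}^D$ be differentiable, with Jacobians $J_t(s) = \frac{\partial f_t}{\partial s}(s) \in \mathbb{R}^{D\times D}$. Let $L \ge 0$ and suppose that for all $1 < t \le T$ and all $s, s' \in \mathbb{R}^D$, $$ \| J_t(s) - J_t(s') \|_2 \ \le\ L \, \| s - s' \|_2 . $$ Then the residual function Jacobian $\mathbf{J}$ is also $L$-Lipschitz with the same $L$: for all $\mathbf{s}, \mathbf{s}' \in \mathbb{R}^{TD}$, $$ \| \mathbf{J}(\mathbf{s}) - \mathbf{J}(\mathbf{s}') \|_2 \ \le\ L \, \| \mathbf{s} - \mathbf{s}' \|_2 . $$
   Context: Consider the nonlinear state space model $s_t = f_t(s_{t-1}) \in \mathbb{R}^D$, $t=1,\dots,T$, with fixed initial condition $s_0$. The residual function is $$\mathbf{r}(\mathbf{s}) = \operatorname{vec}\big([s_1 - f_1(s_0), \ldots, s_T - f_T(s_{T-1})]\big) \in \mathbb{R}^{TD}, \qquad \mathbf{s} = \operatorname{vec}(s_1,\dots,s_T) \in \mathbb{R}^{TD},$$ where $\operatorname{vec}$ stacks vectors into one column. Its Jacobian $\mathbf{J}(\mathbf{s}) = \frac{\partial \mathbf{r}}{\partial \mathbf{s}}(\mathbf{s}) \in \mathbb{R}^{TD\times TD}$ is block bidiagonal with $D\times D$ blocks: its diagonal blocks are $I_D$, its block in block-row $t$ and block-column $t-1$ is $-J_t(s_{t-1})$ for $t=2,\dots,T$,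 and all other blocks are zero. $\|\cdot\|_2$ denotes the Euclidean norm of vectors and the spectral norm of matrices. *)

theory Defs
  imports "HOL-Analysis.Analysis"
begin

text \<open>
  The number of time steps is \<open>T = CARD('t)\<close> and the state dimension is \<open>D = CARD('d)\<close>.
  The space of stacked vectors (dimension \<open>T * D\<close>) is \<open>real ^ ('t \<times> 'd)\<close>, whose library
  norm is the Euclidean one. The order on \<open>'t\<close> only serves to identify it with \<open>{1..T}\<close>.
\<close>

definition time_index :: "'t::{finite,linorder} \<Rightarrow> nat"
  where "time_index t = card {..t}"

lemma bij_betw_time_index:
  "bij_betw time_index (UNIV :: 't::{finite,linorder} set) {1..CARD('t)}"
proof -
  have inj: "inj (time_index :: 't \<Rightarrow> nat)"
  proof (rule injI)
    fix a b :: 't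
    assume "time_index a = time_index b"
    then have "card {..a} = card {..b}"
      by (simp add: time_index_def)
    moreover have "{..a} \<subseteq> {..b} \<or> {..b} \<subseteq> {..a}"
      by auto
    ultimately have "{..a} = {..b}"
      using card_subset_eq[OF finite, of "{..a}" "{..b}"]
        card_subset_eq[OF finite, of "{..b}" "{..a}"] by auto
    then show "a = b"
      by simp
  qed
  have "time_index t \<in> {1..CARD('t)}" for t :: 't
    by (auto simp: time_index_def card_gt_0_iff Suc_le_eq intro!: card_mono)
  then have "range (time_index :: 't \<Rightarrow> nat) \<subseteq> {1..CARD('t)}"
    by auto
  then have "range (time_index :: 't \<Rightarrow> nat) = {1..CARD('t)}"
    by (intro card_subset_eq) (simp_all add: card_image[OF inj])
  with inj show ?thesis
    by (simp add: bij_betw_def)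
qed

text \<open>\<open>stack x\<close> is \<open>vec(x 1, \<dots>, x T)\<close>.\<close>

definition stack :: "(nat \<Rightarrow> real ^ 'd) \<Rightarrow> real ^ ('t::{finite,linorder} \<times> 'd::finite)"
  where "stack x = (\<chi> p. x (time_index (fst p)) $ snd p)"

text \<open>
  \<open>state s0 s k\<close> is the block \<open>s_k\<close> of \<open>s = vec(s_1, \<dots>, s_T)\<close>, extended by the
  initial condition at \<open>k = 0\<close>; its value is irrelevant for \<open>k > T\<close>.
\<close>

definition state :: "real ^ 'd \<Rightarrow> real ^ ('t::{finite,linorder} \<times> 'd::finite) \<Rightarrow> nat \<Rightarrow> real ^ 'd"
  where "state s0 s k = (if k = 0 then s0 else (\<chi> i. s $ (inv time_index k, i)))"

lemma state_0 [simp]: "state s0 s 0 = s0"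
  by (simp add: state_def)

lemma state_time_index:
  "state s0 s (time_index t) = (\<chi> i. s $ (t, i))"
proof -
  have "time_index t \<noteq> 0"
    using bij_betw_apply[OF bij_betw_time_index, of t] by simp
  moreover have "inv time_index (time_index t) = t"
    using bij_betw_imp_inj_on[OF bij_betw_time_index] by (rule inv_f_f)
  ultimately show ?thesis
    by (simp add: state_def)
qed

lemma state_stack:
  assumes "k \<in> {1..CARD('t)}"
  shows "state s0 (stack x :: real ^ ('t::{finite,linorder} \<times> 'd::finite)) k = x k"
proof -
  have "k \<in> range (time_index :: 't \<Rightarrow> nat)"
    using assms by (simp only: bij_betw_imp_surj_on[OF bij_betw_time_index])
  then obtain t :: 't where "k = time_index t"
    by blast
  then show ?thesis
    by (simp add: state_time_index stack_def vec_eq_iff)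
qed

lemma stack_state: "stack (state s0 s) = s"
  by (simp add: stack_def state_time_index vec_eq_iff)

definition residual ::
  "(nat \<Rightarrow> real ^ 'd \<Rightarrow> real ^ 'd) \<Rightarrow> real ^ 'd
    \<Rightarrow> real ^ ('t::{finite,linorder} \<times> 'd::finite) \<Rightarrow> real ^ ('t \<times> 'd)"
  where "residual f s0 s = stack (\<lambda>t. state s0 s t - f t (state s0 s (t - 1)))"

text \<open>
  The library norm on \<open>real ^ 'n ^ 'm\<close> is the Frobenius norm, so the spectral norm is
  introduced as the operator norm with respect to the Euclidean norms.
\<close>

definition spectral_norm :: "real ^ 'n::finite ^ 'm::finite \<Rightarrow> real"
  where "spectral_norm A = onorm ((*v) A)"

end

theory Submission
  imports Defs
begin

text \<open>
  Differentiating the residual block by block shows that its Jacobian at \<open>s\<close> sends a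
  direction \<open>h\<close> to the stacked vector with blocks
  \<open>h_t - J_t (s_{t-1}) h_{t-1}\<close>, where \<open>h_0 = 0\<close> because the initial condition is held fixed.
  In the difference of two Jacobians the identity blocks cancel, and what is left has zero
  first block row and, in block row \<open>t > 1\<close>, the single block
  \<open>J_t (s'_{t-1}) - J_t (s_{t-1})\<close> in block column \<open>t - 1\<close>. Blocks in distinct rows thus lie in
  distinct columns, so the operator norm is controlled by the largest block norm, with no loss
  depending on \<open>T\<close>: block \<open>t > 1\<close> of the image of \<open>h\<close> has norm at most
  \<open>L * norm (s_{t-1} - s'_{t-1}) * norm h_{t-1} \<le> L * norm (s - s') * norm h_{t-1}\<close>,
  and the squares of the \<open>norm h_{t-1}\<close> sum to at most the square of \<open>norm h\<close>.
\<close>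

lemma norm_stack_power2:
  "(norm (stack x :: real ^ ('t::{finite,linorder} \<times> 'd::finite)))\<^sup>2
    = (\<Sum>k = 1..CARD('t). (norm (x k))\<^sup>2)"
proof -
  have "(norm (stack x :: real ^ ('t \<times> 'd)))\<^sup>2
      = (\<Sum>p\<in>UNIV \<times> UNIV. (x (time_index (fst p :: 't)) $ snd p)\<^sup>2)"
    by (simp add: norm_vec_def L2_set_def stack_def sum_nonneg)
  also have "\<dots> = (\<Sum>t\<in>(UNIV :: 't set). \<Sum>i\<in>UNIV. (x (time_index t) $ i)\<^sup>2)"
    by (simp only: sum.cartesian_product split_def fst_conv snd_conv)
  also have "\<dots> = (\<Sum>t\<in>(UNIV :: 't set). (norm (x (time_index t)))\<^sup>2)"
    by (simp add: norm_vec_def L2_set_def sum_nonneg)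
  also have "\<dots> = (\<Sum>k = 1..CARD('t). (norm (x k))\<^sup>2)"
    by (rule sum.reindex_bij_betw[OF bij_betw_time_index])
  finally show ?thesis .
qed

lemma norm_power2_eq_sum_state:
  fixes s :: "real ^ ('t::{finite,linorder} \<times> 'd::finite)"
  shows "(norm s)\<^sup>2 = (\<Sum>k = 1..CARD('t). (norm (state c s k))\<^sup>2)"
  using norm_stack_power2[where x = "state c s" and 't = 't] by (simp add: stack_state)

lemma norm_state_le:
  fixes s :: "real ^ ('t::{finite,linorder} \<times> 'd::finite)"
  assumes "k \<le> CARD('t)"
  shows "norm (state 0 s k) \<le> norm s"
proof (cases "k = 0")
  case False
  then have "(norm (state 0 s k))\<^sup>2 \<le> (norm s)\<^sup>2"
    unfolding norm_power2_eq_sum_state[of s 0]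
    using assms by (intro member_le_sum) auto
  then show ?thesis
    by (rule power2_le_imp_le) simp
qed simp

lemma sum_norm_state_shift_le:
  fixes h :: "real ^ ('t::{finite,linorder} \<times> 'd::finite)"
  shows "(\<Sum>k = 1..CARD('t). (norm (state 0 h (k - 1)))\<^sup>2) \<le> (norm h)\<^sup>2"
proof -
  let ?g = "\<lambda>k. (norm (state 0 h k))\<^sup>2"
  have "(\<Sum>k = 1..CARD('t). ?g (k - 1)) = (\<Sum>k<CARD('t). ?g k)"
    by (rule sum.reindex_bij_witness[of _ Suc "\<lambda>k. k - 1"]) auto
  also have "\<dots> \<le> (\<Sum>k\<in>insert 0 {1..CARD('t)}. ?g k)"
    by (intro sum_mono2) auto
  also have "\<dots> = (norm h)\<^sup>2"
    by (simp add: norm_power2_eq_sum_state[of h 0])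
  finally show ?thesis .
qed

lemma state_diff: "state c s k - state c s' k = state 0 (s - s') k"
  by (simp add: state_def vec_eq_iff)

text \<open>
  The blocks depend affinely on the stacked vector, and replacing the initial condition by
  \<open>0\<close> gives the linear part.
\<close>

lemma has_derivative_state:
  fixes s :: "real ^ ('t::{finite,linorder} \<times> 'd::finite)"
  shows "((\<lambda>s. state c s k) has_derivative (\<lambda>h. state 0 h k)) (at s)"
proof -
  have "linear (\<lambda>h :: real ^ ('t \<times> 'd). state 0 h k)"
    by (rule linearI) (auto simp: state_def vec_eq_iff)
  then have "((\<lambda>s. state 0 s k + state c (0 :: real ^ ('t \<times> 'd)) k) has_derivative (\<lambda>h. state 0 h k)) (at s)"
    by (intro has_derivative_add_const linear_imp_has_derivative)
  moreover have "(\<lambda>s :: real ^ ('t \<times> 'd). state 0 s k + state c (0 :: real ^ ('t \<times> 'd)) k) = (\<lambda>s. state c s k)"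
    by (auto simp: state_def vec_eq_iff)
  ultimately show ?thesis
    by simp
qed

lemma has_derivative_stack:
  assumes "\<And>k. k \<in> {1..CARD('t)} \<Longrightarrow> (x k has_derivative x' k) (at s)"
  shows "((\<lambda>s. stack (\<lambda>k. x k s) :: real ^ ('t::{finite,linorder} \<times> 'd::finite))
    has_derivative (\<lambda>h. stack (\<lambda>k. x' k h))) (at s)"
proof -
  have "((\<lambda>s. x (time_index t) s $ i) has_derivative (\<lambda>h. x' (time_index t) h $ i)) (at s)"
    for t :: 't and i
    using bij_betw_apply[OF bij_betw_time_index, of t]
    by (intro bounded_linear.has_derivative[OF bounded_linear_vec_nth] assms) simp
  then show ?thesis
    by (subst has_derivative_componentwise_within)
      (auto simp: Basis_vec_def inner_axis stack_def)
qed

lemma jacobian_mult_vec: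
  fixes g :: "real ^ 'n::finite \<Rightarrow> real ^ 'm::finite"
  assumes "(g has_derivative g') (at x)"
  shows "jacobian g (at x) *v h = g' h"
  using has_derivative_unique[OF assms, of "(*v) (jacobian g (at x))"]
    jacobian_works[THEN iffD1, OF differentiableI[OF assms]]
  by simp

text \<open>
  At \<open>t = 1\<close> the second term vanishes because \<open>state 0 h 0 = 0\<close>, so one formula covers
  the first block row, which has only its diagonal block, and the later ones.
\<close>

lemma jacobian_residual_mult_vec:
  fixes s h :: "real ^ ('t::{finite,linorder} \<times> 'd::finite)"
  assumes "\<And>t x. t \<in> {1..CARD('t)} \<Longrightarrow> f t differentiable (at x)"
  shows "jacobian (residual f s0) (at s) *v h =
    stack (\<lambda>t. state 0 h t - jacobian (f t) (at (state s0 s (t - 1))) *v state 0 h (t - 1))"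
proof (rule jacobian_mult_vec)
  have f: "(f t has_derivative (*v) (jacobian (f t) (at y))) (at y)"
    if "t \<in> {1..CARD('t)}" for t y
    using assms[OF that, of y] by (simp add: jacobian_works)
  show "(residual f s0 has_derivative
    (\<lambda>h. stack (\<lambda>t. state 0 h t - jacobian (f t) (at (state s0 s (t - 1))) *v state 0 h (t - 1)))) (at s)"
    unfolding residual_def
    by (intro has_derivative_stack has_derivative_diff has_derivative_state
        has_derivative_compose[OF has_derivative_state f])
qed

lemma norm_mult_vec_le_spectral_norm: "norm (A *v x) \<le> spectral_norm A * norm x"
  unfolding spectral_norm_def by (rule onorm) simp

text \<open>
  Row \<open>k\<close> of the block matrix \<open>h \<mapsto> stack (\<lambda>k. A k *v state 0 h (k - 1))\<close> reads only block
  \<open>k - 1\<close> of \<open>h\<close>, and row \<open>1\<close> reads \<open>0\<close>. Distinct rows read distinct blocks, so the squared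
  norms of the rows add up to at most \<open>C\<^sup>2\<close> times the squared norm of \<open>h\<close>.
\<close>

lemma norm_stack_shift_le:
  fixes h :: "real ^ ('t::{finite,linorder} \<times> 'd::finite)"
  assumes A: "\<And>k. 1 < k \<Longrightarrow> k \<le> CARD('t) \<Longrightarrow> spectral_norm (A k) \<le> C" and "C \<ge> 0"
  shows "norm (stack (\<lambda>k. A k *v state 0 h (k - 1)) :: real ^ ('t \<times> 'd)) \<le> C * norm h"
proof (rule power2_le_imp_le)
  have "norm (A k *v state 0 h (k - 1)) \<le> C * norm (state 0 h (k - 1))"
    if "k \<in> {1..CARD('t)}" for k
  proof (cases "k = 1")
    case False
    then have "spectral_norm (A k) \<le> C"
      using that by (intro A) auto
    then show ?thesis
      by (meson norm_mult_vec_le_spectral_norm mult_right_mono norm_ge_zero order_trans)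
  qed simp
  then have "(norm (A k *v state 0 h (k - 1)))\<^sup>2 \<le> C\<^sup>2 * (norm (state 0 h (k - 1)))\<^sup>2"
    if "k \<in> {1..CARD('t)}" for k
    using that by (metis norm_ge_zero power_mono power_mult_distrib)
  then have "(\<Sum>k = 1..CARD('t). (norm (A k *v state 0 h (k - 1)))\<^sup>2)
      \<le> (\<Sum>k = 1..CARD('t). C\<^sup>2 * (norm (state 0 h (k - 1)))\<^sup>2)"
    by (rule sum_mono)
  also have "\<dots> \<le> C\<^sup>2 * (norm h)\<^sup>2"
    unfolding sum_distrib_left[symmetric]
    by (intro mult_left_mono sum_norm_state_shift_le) simp
  finally show "(norm (stack (\<lambda>k. A k *v state 0 h (k - 1)) :: real ^ ('t \<times> 'd)))\<^sup>2
      \<le> (C * norm h)\<^sup>2"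
    by (simp add: norm_stack_power2 power_mult_distrib)
qed (use \<open>C \<ge> 0\<close> in simp)

theorem theorem3:
  fixes f :: "nat \<Rightarrow> real ^ 'd \<Rightarrow> real ^ 'd"
    and s0 :: "real ^ 'd"
    and L :: real
  assumes "\<And>t x. t \<in> {1..CARD('t::{finite,linorder})} \<Longrightarrow> f t differentiable (at x)"
    and "L \<ge> 0"
    and "\<And>t x x'. 1 < t \<Longrightarrow> t \<le> CARD('t) \<Longrightarrow>
      spectral_norm (jacobian (f t) (at x) - jacobian (f t) (at x')) \<le> L * norm (x - x')"
  shows "\<forall>s s' :: real ^ ('t \<times> 'd).
    spectral_norm (jacobian (residual f s0) (at s) - jacobian (residual f s0) (at s'))
      \<le> L * norm (s - s')"
proof (intro allI)
  fix s s' :: "real ^ ('t \<times> 'd)"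
  \<comment> \<open>The order is reversed so that the minus sign of the off-diagonal blocks disappears.\<close>
  define A where "A k = jacobian (f k) (at (state s0 s' (k - 1)))
    - jacobian (f k) (at (state s0 s (k - 1)))" for k
  have A: "spectral_norm (A k) \<le> L * norm (s - s')" if k: "1 < k" "k \<le> CARD('t)" for k
  proof -
    have "spectral_norm (A k) \<le> L * norm (state 0 (s' - s) (k - 1))"
      unfolding A_def state_diff[of s0, symmetric] by (rule assms(3)[OF k])
    also have "\<dots> \<le> L * norm (s' - s)"
      using k \<open>L \<ge> 0\<close> by (intro mult_left_mono norm_state_le) auto
    finally show ?thesis
      by (simp add: norm_minus_commute)
  qed
  have J: "jacobian (residual f s0) (at u) *v h =
      stack (\<lambda>t. state 0 h t - jacobian (f t) (at (state s0 u (t - 1))) *v state 0 h (t - 1))"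
    for u h :: "real ^ ('t \<times> 'd)"
    by (rule jacobian_residual_mult_vec) (rule assms(1))
  have "(jacobian (residual f s0) (at s) - jacobian (residual f s0) (at s')) *v h
      = stack (\<lambda>k. A k *v state 0 h (k - 1))" for h
    by (simp add: matrix_vector_mult_diff_rdistrib J A_def stack_def vec_eq_iff)
  then show "spectral_norm (jacobian (residual f s0) (at s) - jacobian (residual f s0) (at s'))
      \<le> L * norm (s - s')"
    unfolding spectral_norm_def
    using norm_stack_shift_le[of A, OF A] \<open>L \<ge> 0\<close> by (intro onorm_le) simp
qed

end
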